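(* Let $\kappa$ be a field, $G$ an infinite group and $\sigma\in pm(G)$ a factor set. Then the following are equivalent: (i) the spectral partial action $\hat\theta$ of $G$ on $\Omega_\sigma$ is not topologically free; (ii) there exists an element $g\in G\setminus\{1\}$ such that $\operatorname{Fix}^\sigma_g$ contains isolated points of $\Omega_\sigma$; (iii) there exist $g\in G\setminus\{1\}$ and $\xi\in\operatorname{Fix}^\sigma_g$ such that $|\xi|<\infty$ and $|A_\sigma(\xi)|<\infty$.
   Context: A partial projective $\sigma$-representation of $G$ in a unital (associative) $\kappa$-algebra $R$ (with $1_R\neq 0$) is a map $\Gamma:G\to R$ for which there is a function $\sigma:G\times G\to\kappa$ (called the factor set) such that for all $g,h\in G$: (i) if $\sigma(g,h)=0$ then $\Gamma(g^{-1})\Gamma(gh)=0$ and $\Gamma(gh)\Gamma(h^{-1})=0$; (ii) if $\Gamma(g)\Gamma(h)=0$ then $\sigma(g,h)=0$; (iii) $\Gamma(1_G)=1_R$; (iv) $\Gamma(g^{-1})\Gamma(g)\Gamma(h)=\sigma(g,h)\Gamma(g^{-1})\Gamma(gh)$; (v) $\Gamma(g)\Gamma(h)\Gamma(h^{-1})=\sigma(g,h)\Gamma(gh)\Gamma(h^{-1})$. The set of all factor sets of $G$ (over all such $R$ and $\Gamma$) is $pm(G)$. Let $\Omega=\{\xi\subseteq G:1\in\xi\}$, identified with $\prod_{g\in G\setminus\{1\}}\{0,1\}$ and given the product topology. The $\sigma$-prohibitions of type I are the sets $\{h,hg,hgs\}$ with $h,g,s\in G$ and $\sigma(g,s)=0$;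 those of type II are the sets $\{h,hg,hgs,hgst\}$ with $h,g,s,t\in G$ and $\sigma(g,st)\sigma(s,t)\neq\sigma(g,s)\sigma(gs,t)$. $\mathcal{P}_\sigma$ is the set of all $\sigma$-prohibitions, and $\Omega_\sigma=\{\xi\in\Omega: V\nsubseteq\xi\text{ for all }V\in\mathcal{P}_\sigma\}$ with the subspace topology. The spectral partial action $\hat\theta$ of $G$ on $\Omega_\sigma$ is given by the clopen sets $\hat D_g=\{\xi\in\Omega_\sigma:g\in\xi\}$ and the homeomorphisms $\hat\theta_g:\hat D_{g^{-1}}\to\hat D_g$, $\hat\theta_g(\xi)=g\xi$. For $g\in G$, $\operatorname{Fix}^\sigma_g=\{\xi\in\hat D_{g^{-1}}:\hat\theta_g(\xi)=\xi\}$. For $\xi\in\Omega_\sigma$, $A_\sigma(\xi)=\{g\in G\setminus\xi:\xi\cup\{g\}\in\Omega_\sigma\}$. A topological partial action $(\{X_g\},\{\theta_g:X_{g^{-1}}\to X_g\})$ of $G$ on a space $X$ is topologically free if for every $g\neq1_G$ the set $\{x\in X_{g^{-1}}:\theta_g(x)=x\}$ has empty interior. *)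

theory Defs
  imports "HOL-Analysis.Analysis" "HOL-Algebra.Module" "HOL-Algebra.Coset"
begin

(* The library locale "algebra" assumes the multiplication of the algebra to be commutative,
   so unital associative algebras are introduced here. *)
locale assoc_algebra = Module.module K R + ring R for K and R (structure) +
  assumes smult_mult_left:
      "\<lbrakk>a \<in> carrier K; x \<in> carrier R; y \<in> carrier R\<rbrakk>
        \<Longrightarrow> (a \<odot>\<^bsub>R\<^esub> x) \<otimes>\<^bsub>R\<^esub> y = a \<odot>\<^bsub>R\<^esub> (x \<otimes>\<^bsub>R\<^esub> y)"
    and smult_mult_right:
      "\<lbrakk>a \<in> carrier K; x \<in> carrier R; y \<in> carrier R\<rbrakk>
        \<Longrightarrow> x \<otimes>\<^bsub>R\<^esub> (a \<odot>\<^bsub>R\<^esub> y) = a \<odot>\<^bsub>R\<^esub> (x \<otimes>\<^bsub>R\<^esub> y)"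

definition partial_projective_rep ::
  "('k, 'm) ring_scheme \<Rightarrow> ('g, 'n) monoid_scheme \<Rightarrow> ('k, 'r, 'l) module_scheme \<Rightarrow>
    ('g \<Rightarrow> 'r) \<Rightarrow> ('g \<times> 'g \<Rightarrow> 'k) \<Rightarrow> bool"
  where "partial_projective_rep K G R \<Gamma> \<sigma> \<longleftrightarrow>
    \<Gamma> \<in> carrier G \<rightarrow> carrier R \<and>
    \<sigma> \<in> carrier G \<times> carrier G \<rightarrow> carrier K \<and>
    \<Gamma> \<one>\<^bsub>G\<^esub> = \<one>\<^bsub>R\<^esub> \<and>
    (\<forall>g\<in>carrier G. \<forall>h\<in>carrier G.
      (\<sigma> (g, h) = \<zero>\<^bsub>K\<^esub> \<longrightarrow>
         \<Gamma> (inv\<^bsub>G\<^esub> g) \<otimes>\<^bsub>R\<^esub> \<Gamma> (g \<otimes>\<^bsub>G\<^esub> h) = \<zero>\<^bsub>R\<^esub> \<and>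
         \<Gamma> (g \<otimes>\<^bsub>G\<^esub> h) \<otimes>\<^bsub>R\<^esub> \<Gamma> (inv\<^bsub>G\<^esub> h) = \<zero>\<^bsub>R\<^esub>) \<and>
      (\<Gamma> g \<otimes>\<^bsub>R\<^esub> \<Gamma> h = \<zero>\<^bsub>R\<^esub> \<longrightarrow> \<sigma> (g, h) = \<zero>\<^bsub>K\<^esub>) \<and>
      \<Gamma> (inv\<^bsub>G\<^esub> g) \<otimes>\<^bsub>R\<^esub> \<Gamma> g \<otimes>\<^bsub>R\<^esub> \<Gamma> h =
        \<sigma> (g, h) \<odot>\<^bsub>R\<^esub> (\<Gamma> (inv\<^bsub>G\<^esub> g) \<otimes>\<^bsub>R\<^esub> \<Gamma> (g \<otimes>\<^bsub>G\<^esub> h)) \<and>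
      \<Gamma> g \<otimes>\<^bsub>R\<^esub> \<Gamma> h \<otimes>\<^bsub>R\<^esub> \<Gamma> (inv\<^bsub>G\<^esub> h) =
        \<sigma> (g, h) \<odot>\<^bsub>R\<^esub> (\<Gamma> (g \<otimes>\<^bsub>G\<^esub> h) \<otimes>\<^bsub>R\<^esub> \<Gamma> (inv\<^bsub>G\<^esub> h)))"

(* A formula cannot quantify over types, so the type 'r carrying the algebras R is a parameter.
   A theorem about all \<sigma> in pm TYPE('r) K G with 'r a type variable covers the factor sets
   arising from all algebras R.  Values of \<sigma> outside carrier G \<times> carrier G are irrelevant. *)
definition pm ::
  "'r itself \<Rightarrow> ('k, 'm) ring_scheme \<Rightarrow> ('g, 'n) monoid_scheme \<Rightarrow> ('g \<times> 'g \<Rightarrow> 'k) set"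
  where "pm _ K G =
    {\<sigma>. \<exists>(R :: ('k, 'r) module) \<Gamma>.
      assoc_algebra K R \<and> \<one>\<^bsub>R\<^esub> \<noteq> \<zero>\<^bsub>R\<^esub> \<and> partial_projective_rep K G R \<Gamma> \<sigma>}"

definition Omega :: "('g, 'n) monoid_scheme \<Rightarrow> 'g set set"
  where "Omega G = {\<xi>. \<xi> \<subseteq> carrier G \<and> \<one>\<^bsub>G\<^esub> \<in> \<xi>}"

(* The product topology is transported to Omega along the bijection sending a set to its
   characteristic function on carrier G - {\<one>}. *)
definition Omega_topology :: "('g, 'n) monoid_scheme \<Rightarrow> 'g set topology"
  where "Omega_topology G =
    pullback_topology (Omega G) (\<lambda>\<xi>. \<lambda>g\<in>carrier G - {\<one>\<^bsub>G\<^esub>}. g \<in> \<xi>)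
      (product_topology (\<lambda>_. discrete_topology (UNIV :: bool set)) (carrier G - {\<one>\<^bsub>G\<^esub>}))"

definition prohibitions_I ::
  "('k, 'm) ring_scheme \<Rightarrow> ('g, 'n) monoid_scheme \<Rightarrow> ('g \<times> 'g \<Rightarrow> 'k) \<Rightarrow> 'g set set"
  where "prohibitions_I K G \<sigma> =
    {{h, h \<otimes>\<^bsub>G\<^esub> g, h \<otimes>\<^bsub>G\<^esub> g \<otimes>\<^bsub>G\<^esub> s} | h g s.
      h \<in> carrier G \<and> g \<in> carrier G \<and> s \<in> carrier G \<and> \<sigma> (g, s) = \<zero>\<^bsub>K\<^esub>}"

definition prohibitions_II ::
  "('k, 'm) ring_scheme \<Rightarrow> ('g, 'n) monoid_scheme \<Rightarrow> ('g \<times> 'g \<Rightarrow> 'k) \<Rightarrow> 'g set set"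
  where "prohibitions_II K G \<sigma> =
    {{h, h \<otimes>\<^bsub>G\<^esub> g, h \<otimes>\<^bsub>G\<^esub> g \<otimes>\<^bsub>G\<^esub> s, h \<otimes>\<^bsub>G\<^esub> g \<otimes>\<^bsub>G\<^esub> s \<otimes>\<^bsub>G\<^esub> t} | h g s t.
      h \<in> carrier G \<and> g \<in> carrier G \<and> s \<in> carrier G \<and> t \<in> carrier G \<and>
      \<sigma> (g, s \<otimes>\<^bsub>G\<^esub> t) \<otimes>\<^bsub>K\<^esub> \<sigma> (s, t) \<noteq> \<sigma> (g, s) \<otimes>\<^bsub>K\<^esub> \<sigma> (g \<otimes>\<^bsub>G\<^esub> s, t)}"

definition prohibitions ::
  "('k, 'm) ring_scheme \<Rightarrow> ('g, 'n) monoid_scheme \<Rightarrow> ('g \<times> 'g \<Rightarrow> 'k) \<Rightarrow> 'g set set"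
  where "prohibitions K G \<sigma> = prohibitions_I K G \<sigma> \<union> prohibitions_II K G \<sigma>"

definition Omega_sigma ::
  "('k, 'm) ring_scheme \<Rightarrow> ('g, 'n) monoid_scheme \<Rightarrow> ('g \<times> 'g \<Rightarrow> 'k) \<Rightarrow> 'g set set"
  where "Omega_sigma K G \<sigma> = {\<xi> \<in> Omega G. \<forall>V\<in>prohibitions K G \<sigma>. \<not> V \<subseteq> \<xi>}"

definition Omega_sigma_topology ::
  "('k, 'm) ring_scheme \<Rightarrow> ('g, 'n) monoid_scheme \<Rightarrow> ('g \<times> 'g \<Rightarrow> 'k) \<Rightarrow> 'g set topology"
  where "Omega_sigma_topology K G \<sigma> = subtopology (Omega_topology G) (Omega_sigma K G \<sigma>)"

(* A partial action on the space X is given by its domains D g and its maps \<theta> g, where \<theta> g is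
   considered on D (inv g) only. *)
definition fixed_points ::
  "('g, 'n) monoid_scheme \<Rightarrow> ('g \<Rightarrow> 'x set) \<Rightarrow> ('g \<Rightarrow> 'x \<Rightarrow> 'x) \<Rightarrow> 'g \<Rightarrow> 'x set"
  where "fixed_points G D \<theta> g = {x \<in> D (inv\<^bsub>G\<^esub> g). \<theta> g x = x}"

definition topologically_free ::
  "('g, 'n) monoid_scheme \<Rightarrow> 'x topology \<Rightarrow> ('g \<Rightarrow> 'x set) \<Rightarrow> ('g \<Rightarrow> 'x \<Rightarrow> 'x) \<Rightarrow> bool"
  where "topologically_free G X D \<theta> \<longleftrightarrow>
    (\<forall>g \<in> carrier G - {\<one>\<^bsub>G\<^esub>}. X interior_of (fixed_points G D \<theta> g) = {})"

definition spectral_domain ::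
  "('k, 'm) ring_scheme \<Rightarrow> ('g, 'n) monoid_scheme \<Rightarrow> ('g \<times> 'g \<Rightarrow> 'k) \<Rightarrow> 'g \<Rightarrow> 'g set set"
  where "spectral_domain K G \<sigma> g = {\<xi> \<in> Omega_sigma K G \<sigma>. g \<in> \<xi>}"

definition spectral_map :: "('g, 'n) monoid_scheme \<Rightarrow> 'g \<Rightarrow> 'g set \<Rightarrow> 'g set"
  where "spectral_map G g \<xi> = g <#\<^bsub>G\<^esub> \<xi>"

definition Fix_sigma ::
  "('k, 'm) ring_scheme \<Rightarrow> ('g, 'n) monoid_scheme \<Rightarrow> ('g \<times> 'g \<Rightarrow> 'k) \<Rightarrow> 'g \<Rightarrow> 'g set set"
  where "Fix_sigma K G \<sigma> g = fixed_points G (spectral_domain K G \<sigma>) (spectral_map G) g"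

definition A_sigma ::
  "('k, 'm) ring_scheme \<Rightarrow> ('g, 'n) monoid_scheme \<Rightarrow> ('g \<times> 'g \<Rightarrow> 'k) \<Rightarrow> 'g set \<Rightarrow> 'g set"
  where "A_sigma K G \<sigma> \<xi> = {g \<in> carrier G - \<xi>. \<xi> \<union> {g} \<in> Omega_sigma K G \<sigma>}"

definition isolated_point_of :: "'x \<Rightarrow> 'x topology \<Rightarrow> bool"
  where "isolated_point_of x X \<longleftrightarrow> x \<in> topspace X \<and> openin X {x}"

end

theory Submission
  imports Defs
begin

text \<open>
  A set \<open>\<Omega>\<^sub>\<sigma>\<close> defined by prohibitions is closed under passing to subsets containing \<open>1\<close>.
  Hence a nonempty open set \<open>U\<close> of fixed points of \<open>g \<noteq> 1\<close>, which around a point constrains only the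
  coordinates in a finite set \<open>F\<close>, contains a finite point \<open>\<eta> \<subseteq> F\<close>. If \<open>h \<in> A\<^sub>\<sigma>(\<eta>)\<close> lay outside \<open>F\<close>,
  then \<open>\<eta> \<union> {h}\<close> would be in \<open>U\<close>, and \<open>g\<close>, fixing both \<open>\<eta>\<close> and \<open>\<eta> \<union> {h}\<close>, would fix \<open>h\<close>; so
  \<open>A\<^sub>\<sigma>(\<eta>) \<subseteq> F\<close> is finite. Conversely, a finite \<open>\<xi>\<close> with \<open>A\<^sub>\<sigma>(\<xi>)\<close> finite is the only point of
  \<open>\<Omega>\<^sub>\<sigma>\<close> that contains \<open>\<xi>\<close> and misses \<open>A\<^sub>\<sigma>(\<xi>)\<close>, hence isolated.
\<close>

text \<open>A basic open set of a product of discrete spaces restricts only finitely many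
  coordinates, so the points that agree with \<open>\<xi>\<close> on a finite \<open>F\<close> form
  neighbourhoods that shrink to \<open>\<xi>\<close>. All later arguments use this criterion instead
  of the pullback.\<close>

lemma openin_Omega_topology:
  "openin (Omega_topology G) U \<longleftrightarrow>
    U \<subseteq> Omega G \<and>
    (\<forall>\<xi>\<in>U. \<exists>F. finite F \<and> F \<subseteq> carrier G \<and> (\<forall>\<eta>\<in>Omega G. \<eta> \<inter> F = \<xi> \<inter> F \<longrightarrow> \<eta> \<in> U))"
  (is "?open U \<longleftrightarrow> ?sub U \<and> ?nhd U")
proof -
  define I where "I = carrier G - {\<one>\<^bsub>G\<^esub>}"
  define T where "T = product_topology (\<lambda>_. discrete_topology (UNIV :: bool set)) I"
  define f where "f = (\<lambda>\<xi>. \<lambda>g\<in>I. g \<in> \<xi>)"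
  have open_iff: "?open U \<longleftrightarrow> (\<exists>V. openin T V \<and> U = f -` V \<inter> Omega G)" for U
    by (simp add: Omega_topology_def openin_pullback_topology T_def I_def f_def)
  have box: "?open ({\<eta> \<in> Omega G. \<eta> \<inter> F = \<xi> \<inter> F})"
    if "finite F" "F \<subseteq> carrier G" "\<xi> \<in> Omega G" for F \<xi>
  proof -
    \<comment> \<open>Here \<open>{g \<in> \<xi>}\<close> is the singleton of a truth value: the box
      pins each coordinate in \<open>F\<close> to its value at \<open>\<xi>\<close>. If
      \<open>F\<close> contains the unit, which is no coordinate, nothing is lost, since all points
      of \<open>Omega G\<close> contain it.\<close>
    define X where "X = (\<lambda>g. if g \<in> F then {g \<in> \<xi>} else UNIV)"
    have "openin T (PiE I X)"
      unfolding T_def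
    proof (rule product_topology_basis)
      show "finite {i. X i \<noteq> topspace (discrete_topology UNIV)}"
        by (rule finite_subset[OF _ \<open>finite F\<close>]) (auto simp: X_def)
    qed auto
    moreover have "{\<eta> \<in> Omega G. \<eta> \<inter> F = \<xi> \<inter> F} = f -` PiE I X \<inter> Omega G"
      using that by (fastforce simp: f_def X_def I_def Omega_def PiE_iff split: if_splits)
    ultimately show ?thesis
      unfolding open_iff by blast
  qed
  show ?thesis
  proof (intro iffI conjI ballI)
    assume "?open U"
    then obtain V where V: "openin T V" "U = f -` V \<inter> Omega G"
      unfolding open_iff by blast
    show "U \<subseteq> Omega G"
      using V by blast
    fix \<xi> assume "\<xi> \<in> U"
    then have "f \<xi> \<in> V" "\<xi> \<in> Omega G"
      using V by auto
    then obtain X where X: "f \<xi> \<in> PiE I X" "finite {i. X i \<noteq> UNIV}" "PiE I X \<subseteq> V"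
      using product_topology_open_contains_basis[OF V(1)[unfolded T_def]]
      unfolding topspace_discrete_topology by blast
    \<comment> \<open>\<open>PiE I X\<close> ignores factors outside \<open>I\<close>; cutting down
      to \<open>I\<close> also places \<open>F\<close> inside \<open>carrier G\<close>.\<close>
    define F where "F = I \<inter> {i. X i \<noteq> UNIV}"
    have "\<eta> \<in> U" if "\<eta> \<in> Omega G" "\<eta> \<inter> F = \<xi> \<inter> F" for \<eta>
    proof -
      have "(g \<in> \<eta>) \<in> X g" if "g \<in> I" for g
      proof (cases "g \<in> F")
        case True
        then have "g \<in> \<eta> \<longleftrightarrow> g \<in> \<xi>"
          using \<open>\<eta> \<inter> F = \<xi> \<inter> F\<close> by blast
        then show ?thesis
          using X(1) that by (auto simp: f_def PiE_iff)
      qed (use that in \<open>auto simp: F_def\<close>)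
      then have "f \<eta> \<in> PiE I X"
        by (auto simp: f_def)
      then show ?thesis
        using X(3) V(2) that by blast
    qed
    moreover have "finite F" "F \<subseteq> carrier G"
      using X(2) by (auto simp: F_def I_def)
    ultimately show "\<exists>F. finite F \<and> F \<subseteq> carrier G \<and> (\<forall>\<eta>\<in>Omega G. \<eta> \<inter> F = \<xi> \<inter> F \<longrightarrow> \<eta> \<in> U)"
      by blast
  next
    assume U: "?sub U \<and> ?nhd U"
    show "?open U"
    proof (subst openin_subopen, intro ballI)
      fix \<xi> assume "\<xi> \<in> U"
      with U obtain F where F: "finite F" "F \<subseteq> carrier G"
        "\<forall>\<eta>\<in>Omega G. \<eta> \<inter> F = \<xi> \<inter> F \<longrightarrow> \<eta> \<in> U"
        by blast
      then show "\<exists>T. ?open T \<and> \<xi> \<in> T \<and> T \<subseteq> U"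
        using box[of F \<xi>] U \<open>\<xi> \<in> U\<close> by (intro exI[of _ "{\<eta> \<in> Omega G. \<eta> \<inter> F = \<xi> \<inter> F}"]) auto
    qed
  qed
qed

lemma Omega_sigma_subset_Omega: "Omega_sigma K G \<sigma> \<subseteq> Omega G"
  by (auto simp: Omega_sigma_def)

lemma topspace_Omega_sigma_topology:
  "topspace (Omega_sigma_topology K G \<sigma>) = Omega_sigma K G \<sigma>"
proof -
  have "openin (Omega_topology G) (Omega G)"
    unfolding openin_Omega_topology by blast
  then have "topspace (Omega_topology G) = Omega G"
    by (metis openin_Omega_topology openin_subset openin_topspace subset_antisym)
  then show ?thesis
    using Omega_sigma_subset_Omega[of K G \<sigma>] by (auto simp: Omega_sigma_topology_def)
qed

lemma openin_Omega_sigma_topologyD: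
  assumes "openin (Omega_sigma_topology K G \<sigma>) U" "\<xi> \<in> U"
  obtains F where "finite F" "F \<subseteq> carrier G"
    "\<And>\<eta>. \<lbrakk>\<eta> \<in> Omega_sigma K G \<sigma>; \<eta> \<inter> F = \<xi> \<inter> F\<rbrakk> \<Longrightarrow> \<eta> \<in> U"
proof -
  obtain V where V: "openin (Omega_topology G) V" "U = V \<inter> Omega_sigma K G \<sigma>"
    using assms(1) unfolding Omega_sigma_topology_def openin_subtopology by blast
  then obtain F where "finite F" "F \<subseteq> carrier G" "\<forall>\<eta>\<in>Omega G. \<eta> \<inter> F = \<xi> \<inter> F \<longrightarrow> \<eta> \<in> V"
    using assms(2) unfolding openin_Omega_topology by blast
  with V(2) Omega_sigma_subset_Omega[of K G \<sigma>] show ?thesis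
    by (intro that[of F]) auto
qed

lemma Omega_sigma_mono:
  assumes "\<xi> \<in> Omega_sigma K G \<sigma>" "\<eta> \<subseteq> \<xi>" "\<one>\<^bsub>G\<^esub> \<in> \<eta>"
  shows "\<eta> \<in> Omega_sigma K G \<sigma>"
  using assms unfolding Omega_sigma_def Omega_def by blast

lemma isolated_point_of_Omega_sigma:
  assumes "\<xi> \<in> Omega_sigma K G \<sigma>" "finite \<xi>" "finite (A_sigma K G \<sigma> \<xi>)"
  shows "isolated_point_of \<xi> (Omega_sigma_topology K G \<sigma>)"
proof -
  \<comment> \<open>Agreement with \<open>\<xi>\<close> on the first part forces a point to contain
    \<open>\<xi>\<close>; agreement on the second, which is disjoint from \<open>\<xi>\<close>,
    forces it to miss \<open>A_sigma K G \<sigma> \<xi>\<close>.\<close>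
  define F where "F = \<xi> \<union> A_sigma K G \<sigma> \<xi>"
  define V where "V = {\<eta> \<in> Omega G. \<eta> \<inter> F = \<xi> \<inter> F}"
  have \<xi>: "\<xi> \<subseteq> carrier G" "\<one>\<^bsub>G\<^esub> \<in> \<xi>"
    using assms(1) Omega_sigma_subset_Omega[of K G \<sigma>] by (auto simp: Omega_def)
  then have F: "finite F" "F \<subseteq> carrier G"
    using assms by (auto simp: F_def A_sigma_def)
  have "openin (Omega_topology G) V"
    unfolding openin_Omega_topology using F by (auto simp: V_def)
  moreover have "\<eta> = \<xi>" if "\<eta> \<in> Omega_sigma K G \<sigma>" "\<eta> \<in> V" for \<eta>
  proof (rule ccontr)
    assume "\<eta> \<noteq> \<xi>"
    moreover have "\<xi> \<subseteq> \<eta>"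
      using that(2) by (auto simp: V_def F_def)
    ultimately obtain h where h: "h \<in> \<eta>" "h \<notin> \<xi>"
      by blast
    then have "h \<in> carrier G"
      using that(2) by (auto simp: V_def Omega_def)
    \<comment> \<open>This set lies between \<open>\<xi>\<close> and \<open>\<eta>\<close>, so it
      inherits membership from \<open>\<eta>\<close>.\<close>
    moreover have "\<xi> \<union> {h} \<in> Omega_sigma K G \<sigma>"
      using Omega_sigma_mono[OF that(1), of "\<xi> \<union> {h}"] \<open>\<xi> \<subseteq> \<eta>\<close> h \<xi> by blast
    ultimately have "h \<in> A_sigma K G \<sigma> \<xi>"
      using h by (simp add: A_sigma_def)
    then show False
      using h that(2) by (auto simp: V_def F_def)
  qed
  then have "{\<xi>} = V \<inter> Omega_sigma K G \<sigma>"
    using assms(1) Omega_sigma_subset_Omega[of K G \<sigma>] by (auto simp: V_def)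
  ultimately have "openin (Omega_sigma_topology K G \<sigma>) {\<xi>}"
    unfolding Omega_sigma_topology_def openin_subtopology by blast
  then show ?thesis
    using assms(1) by (simp add: isolated_point_of_def topspace_Omega_sigma_topology)
qed

text \<open>Left translation by \<open>g\<close> is injective and maps \<open>\<eta>\<close> onto
  itself, so it sends nothing from outside into \<open>\<eta>\<close>. The new point
  \<open>h\<close> can therefore only go to itself, and cancelling \<open>h\<close> leaves the
  unit.\<close>

lemma (in group) eq_one_if_translation_fixes_insert:
  assumes "g \<in> carrier G" "h \<in> carrier G" "\<eta> \<subseteq> carrier G" "h \<notin> \<eta>"
    and "g <# \<eta> = \<eta>" "g <# (\<eta> \<union> {h}) = \<eta> \<union> {h}"
  shows "g = \<one>"
proof -
  have "g \<otimes> h \<notin> \<eta>"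
  proof
    assume "g \<otimes> h \<in> \<eta>"
    then obtain k where "k \<in> \<eta>" "g \<otimes> h = g \<otimes> k"
      using assms(5) unfolding l_coset_def by blast
    then show False
      using assms(1-4) by (metis Units_eq Units_l_cancel subsetD)
  qed
  moreover have "g \<otimes> h \<in> \<eta> \<union> {h}"
    using assms(6) unfolding l_coset_def by blast
  ultimately show ?thesis
    using assms(1,2) by (simp add: r_cancel_one)
qed

lemma finite_fixed_point_if_open_fixed:
  assumes "group G" "g \<in> carrier G" "g \<noteq> \<one>\<^bsub>G\<^esub>"
    and U: "openin (Omega_sigma_topology K G \<sigma>) U" "U \<subseteq> Fix_sigma K G \<sigma> g" "U \<noteq> {}"
  shows "\<exists>\<xi>\<in>Fix_sigma K G \<sigma> g. finite \<xi> \<and> finite (A_sigma K G \<sigma> \<xi>)"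
proof -
  obtain \<xi> where "\<xi> \<in> U"
    using U(3) by blast
  obtain F where F: "finite F" "F \<subseteq> carrier G"
    and F_nhd: "\<And>\<eta>. \<lbrakk>\<eta> \<in> Omega_sigma K G \<sigma>; \<eta> \<inter> F = \<xi> \<inter> F\<rbrakk> \<Longrightarrow> \<eta> \<in> U"
    using openin_Omega_sigma_topologyD[OF U(1) \<open>\<xi> \<in> U\<close>] by blast
  have fix_U: "g <#\<^bsub>G\<^esub> \<eta> = \<eta>" if "\<eta> \<in> U" for \<eta>
    using that U(2) by (auto simp: Fix_sigma_def fixed_points_def spectral_map_def)
  have \<xi>: "\<xi> \<in> Omega_sigma K G \<sigma>"
    using openin_subset[OF U(1)] \<open>\<xi> \<in> U\<close> by (auto simp: topspace_Omega_sigma_topology)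
  then have "\<one>\<^bsub>G\<^esub> \<in> \<xi>" "\<xi> \<subseteq> carrier G"
    using Omega_sigma_subset_Omega[of K G \<sigma>] by (auto simp: Omega_def)
  \<comment> \<open>The unit is adjoined because \<open>F\<close> may miss it while every point must
    contain it; agreement with \<open>\<xi>\<close> on \<open>F\<close> is unaffected.\<close>
  define \<eta> where "\<eta> = \<xi> \<inter> (F \<union> {\<one>\<^bsub>G\<^esub>})"
  have "\<eta> \<in> Omega_sigma K G \<sigma>"
    using Omega_sigma_mono[OF \<xi>] \<open>\<one>\<^bsub>G\<^esub> \<in> \<xi>\<close> by (auto simp: \<eta>_def)
  then have "\<eta> \<in> U"
    by (rule F_nhd) (auto simp: \<eta>_def)
  have "A_sigma K G \<sigma> \<eta> \<subseteq> F"
  proof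
    fix h assume h: "h \<in> A_sigma K G \<sigma> \<eta>"
    show "h \<in> F"
    proof (rule ccontr)
      assume "h \<notin> F"
      \<comment> \<open>Adding a point outside \<open>F\<close> does not change the trace on
        \<open>F\<close>, and \<open>h \<in> A_sigma K G \<sigma> \<eta>\<close> keeps the enlarged
        set in \<open>Omega_sigma K G \<sigma>\<close>.\<close>
      then have "\<eta> \<union> {h} \<in> U"
        using h by (intro F_nhd) (auto simp: A_sigma_def \<eta>_def)
      then have "g = \<one>\<^bsub>G\<^esub>"
        using group.eq_one_if_translation_fixes_insert[OF assms(1,2), of h \<eta>]
          fix_U \<open>\<eta> \<in> U\<close> h \<open>\<xi> \<subseteq> carrier G\<close> by (auto simp: A_sigma_def \<eta>_def)
      then show False
        using assms(3) by contradiction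
    qed
  qed
  then show ?thesis
    using F(1) \<open>\<eta> \<in> U\<close> U(2) finite_subset by (intro bexI[of _ \<eta>]) (auto simp: \<eta>_def)
qed

theorem theorem8p21:
  fixes K :: "('k, 'm) ring_scheme"
    and G :: "('g, 'n) monoid_scheme"
    and \<sigma> :: "'g \<times> 'g \<Rightarrow> 'k"
  assumes "field K"
    and "group G"
    and "infinite (carrier G)"
    and "\<sigma> \<in> pm TYPE('r) K G"
  shows "(\<not> topologically_free G (Omega_sigma_topology K G \<sigma>)
              (spectral_domain K G \<sigma>) (spectral_map G)
          \<longleftrightarrow> (\<exists>g \<in> carrier G - {\<one>\<^bsub>G\<^esub>}. \<exists>\<xi> \<in> Fix_sigma K G \<sigma> g.
                isolated_point_of \<xi> (Omega_sigma_topology K G \<sigma>)))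
      \<and> ((\<exists>g \<in> carrier G - {\<one>\<^bsub>G\<^esub>}. \<exists>\<xi> \<in> Fix_sigma K G \<sigma> g.
                isolated_point_of \<xi> (Omega_sigma_topology K G \<sigma>))
          \<longleftrightarrow> (\<exists>g \<in> carrier G - {\<one>\<^bsub>G\<^esub>}. \<exists>\<xi> \<in> Fix_sigma K G \<sigma> g.
                finite \<xi> \<and> finite (A_sigma K G \<sigma> \<xi>)))"
proof -
  let ?X = "Omega_sigma_topology K G \<sigma>"
  let ?free = "topologically_free G ?X (spectral_domain K G \<sigma>) (spectral_map G)"
  let ?isolated = "\<exists>g \<in> carrier G - {\<one>\<^bsub>G\<^esub>}. \<exists>\<xi> \<in> Fix_sigma K G \<sigma> g. isolated_point_of \<xi> ?X"
  let ?finite = "\<exists>g \<in> carrier G - {\<one>\<^bsub>G\<^esub>}. \<exists>\<xi> \<in> Fix_sigma K G \<sigma> g.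
    finite \<xi> \<and> finite (A_sigma K G \<sigma> \<xi>)"
  have free_iff: "?free \<longleftrightarrow>
      (\<forall>g \<in> carrier G - {\<one>\<^bsub>G\<^esub>}. ?X interior_of Fix_sigma K G \<sigma> g = {})"
    by (simp add: topologically_free_def Fix_sigma_def)
  \<comment> \<open>The equivalences follow from the cycle (i), (iii), (ii), (i). In this first step
    the open set of fixed points is the interior of \<open>Fix_sigma K G \<sigma> g\<close>.\<close>
  have "?finite" if "\<not> ?free"
  proof -
    from that obtain g where g: "g \<in> carrier G - {\<one>\<^bsub>G\<^esub>}"
      "?X interior_of Fix_sigma K G \<sigma> g \<noteq> {}"
      unfolding free_iff by blast
    then show ?thesis
      using finite_fixed_point_if_open_fixed[OF \<open>group G\<close> _ _ openin_interior_of interior_of_subset]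
      by blast
  qed
  moreover have "?isolated" if "?finite"
  proof -
    have "Fix_sigma K G \<sigma> g \<subseteq> Omega_sigma K G \<sigma>" for g
      by (auto simp: Fix_sigma_def fixed_points_def spectral_domain_def)
    then show ?thesis
      using that isolated_point_of_Omega_sigma by blast
  qed
  moreover have "\<not> ?free" if "?isolated"
  proof -
    from that obtain g \<xi> where g: "g \<in> carrier G - {\<one>\<^bsub>G\<^esub>}" "\<xi> \<in> Fix_sigma K G \<sigma> g"
      "openin ?X {\<xi>}"
      unfolding isolated_point_of_def by blast
    then have "{\<xi>} \<subseteq> ?X interior_of Fix_sigma K G \<sigma> g"
      by (intro interior_of_maximal) auto
    with g(1) show ?thesis
      unfolding free_iff by blast
  qed
  ultimately show ?thesis
    by blast
qed

end
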